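(* Let $\alpha>0$, $\beta>0$. Then the following formulas for the Laplace transforms of the derivatives of the Wright function (for each choice of sign, the same on both sides) $$\mathcal{L}\left(\frac{\partial}{\partial\alpha}\left[W_{\alpha,\beta}(\pm t)\right]\right)(s)=-\frac1s\sum_{k=0}^{\infty}\frac{(\pm1)^k s^{-k}\,k\,\psi(\alpha k+\beta)}{\Gamma(\alpha k+\beta)},$$ $$\mathcal{L}\left(\frac{\partial}{\partial\beta}\left[W_{\alpha,\beta}(\pm t)\right]\right)(s)=-\frac1s\sum_{k=0}^{\infty}\frac{(\pm1)^k s^{-k}\,\psi(\alpha k+\beta)}{\Gamma(\alpha k+\beta)}$$ are valid for all $s\in\mathbb{C}\setminus\{0\}$.
   Context: $W_{\alpha,\beta}(z)=\sum_{k=0}^{\infty}\frac{z^k}{k!\,\Gamma(\alpha k+\beta)}$ is the Wright function. $\psi=\Gamma'/\Gamma$ is the digamma function. The Laplace transform acts in the variable $t>0$: $\mathcal{L}(f(t))(s)=\int_0^\infty e^{-st}f(t)\,dt$.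
   Formalization: The Laplace integral diverges for general s with Re s < 0 (e.g. plus sign, s = -1), so the formulas are proved for the integral when Re s > 0, and on the rest of C\{0} for its analytic continuation, which the right-hand sides are shown to be. *)

theory Defs
  imports "HOL-Complex_Analysis.Complex_Analysis"
begin

definition wright :: "real \<Rightarrow> real \<Rightarrow> 'a \<Rightarrow> 'a::{real_normed_field,banach}" where
  "wright a b z = (\<Sum>k. z ^ k / (fact k * of_real (Gamma (a * real k + b))))"

definition laplace_convergent :: "(real \<Rightarrow> complex) \<Rightarrow> complex \<Rightarrow> bool" where
  "laplace_convergent f s \<longleftrightarrow>
     set_integrable lborel {0<..} (\<lambda>t. exp (- (s * of_real t)) * f t)"

definition laplace :: "(real \<Rightarrow> complex) \<Rightarrow> complex \<Rightarrow> complex" where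
  "laplace f s = (LINT t:{0<..}|lborel. exp (- (s * of_real t)) * f t)"

text \<open>
  The Laplace integral itself lives on a half-plane \<open>Re s > a\<close>; an identity claimed on a
  larger set is an identity for its analytic continuation. The predicate below says that
  the integral converges absolutely for \<open>Re s > a\<close> and that \<open>F\<close> continues it analytically
  to the region \<open>D\<close>. Since \<open>D\<close> is open and connected and contains the half-plane,
  the values of \<open>F\<close> on \<open>D\<close> are uniquely determined by \<open>f\<close>.
\<close>
definition laplace_continuation ::
    "(real \<Rightarrow> complex) \<Rightarrow> real \<Rightarrow> complex set \<Rightarrow> (complex \<Rightarrow> complex) \<Rightarrow> bool" where
  "laplace_continuation f a D F \<longleftrightarrow>
     open D \<and> connected D \<and> {s. Re s > a} \<subseteq> D \<and> F holomorphic_on D \<and>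
     (\<forall>s. Re s > a \<longrightarrow> laplace_convergent f s \<and> laplace f s = F s)"

end

theory Submission imports Defs begin

text \<open>
  Everything rests on one estimate: on a ray \<open>x \<ge> x0 > 0\<close> the function \<open>Digamma x / Gamma x\<close>, which
  up to sign is the derivative of \<open>1 / Gamma\<close>, decays faster than any exponential
  (\<open>Digamma_over_Gamma_bound\<close>). Here \<open>Gamma\<close> outgrows every exponential, as cutting its integral
  off below an arbitrary point shows, while \<open>Digamma\<close> grows at most linearly, its derivative
  being decreasing.

  Boundedness alone already gives a Weierstrass majorant, so the Wright series may be
  differentiated termwise in either parameter (\<open>wright_series_has_derivative\<close>). The derivative at
  \<open>\<sigma> t\<close> is then a series \<open>\<Sum>k. c k * t ^ k / fact k\<close>. Superexponential decay says that
  \<open>\<Sum>k. c k * y ^ k\<close> has infinite radius of convergence. For \<open>Re s > 0\<close> the absolute series of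
  Laplace integrals is then \<open>\<Sum>k. norm (c k) / Re s ^ Suc k < \<infinity>\<close>, so integrating
  \<open>t ^ k / fact k\<close> termwise to \<open>1 / s ^ Suc k\<close> is legitimate on the whole half-plane. The result is an
  entire function of \<open>1 / s\<close> divided by \<open>s\<close>, hence holomorphic off the origin; this is the
  continuation (\<open>laplace_continuation_power_series\<close>). The half-plane on which the integral itself
  converges may not extend further, so for the other \<open>s\<close> the formula speaks of the continuation.

  The two parameters are treated together: both derivatives are instances of a series in
  \<open>1 / Gamma (w k * v + d k)\<close>, with \<open>w k = k\<close> when \<open>v\<close> is the first parameter and \<open>w k = 1\<close> when it
  is the second. The bound \<open>\<bar>w k\<bar> \<le> 2 ^ k\<close> covers both weights and only rescales the argument of
  the power series.
\<close>

section \<open>Growth of the reciprocal Gamma and Digamma functions\<close>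

lemma mult_exp_minus_le_one: "x * exp (- x) \<le> 1" for x :: real
proof -
  have "x * exp (- x) \<le> exp x * exp (- x)"
    using exp_ge_add_one_self[of x] by (intro mult_right_mono) (linarith, simp)
  thus ?thesis by (simp flip: exp_add)
qed

lemma pos_notin_nonpos_Ints: "x > 0 \<Longrightarrow> x \<notin> \<int>\<^sub>\<le>\<^sub>0" for x :: real
  by (auto elim!: nonpos_Ints_cases)

text \<open>
  Euler's integral for \<open>Gamma (x + 1)\<close> has a nonnegative integrand, so it may be restricted to
  \<open>t \<ge> R\<close>, where \<open>t powr x \<ge> R powr x\<close>.
\<close>
lemma Gamma_plus1_ge:
  fixes x R :: real
  assumes "x > 0" "R > 0"
  shows "Gamma (x + 1) \<ge> R powr x * exp (- R)"
proof -
  have "((\<lambda>t. exp (- 1 * t)) has_integral exp (- 1 * R) / 1) {R..}"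
    by (rule has_integral_exp_minus_to_infinity) simp
  hence "((\<lambda>t. R powr x * exp (- t)) has_integral R powr x * exp (- R)) {R..}"
    by (intro has_integral_mult_right) simp
  hence "((\<lambda>t. if t \<in> {R..} then R powr x * exp (- t) else 0) has_integral
           R powr x * exp (- R)) {0..}"
    using assms by (subst has_integral_restrict) auto
  moreover have "((\<lambda>t. t powr x / exp t) has_integral Gamma (x + 1)) {0..}"
    using Gamma_integral_real[of "x + 1"] assms by simp
  ultimately show ?thesis
    by (rule has_integral_le)
      (use assms in \<open>auto simp: exp_minus field_simps intro!: powr_mono2\<close>)
qed

text \<open>
  The cut-off \<open>R = exp (c + 1)\<close> turns \<open>R powr (- x)\<close> into \<open>exp (- (c + 1) * x)\<close>. The surplus
  factor \<open>exp (- x)\<close> absorbs the \<open>x\<close> from \<open>Gamma (x + 1) = x * Gamma x\<close>, so that one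
  constant serves all \<open>x > 0\<close>.
\<close>
lemma inverse_Gamma_le:
  fixes x c :: real
  assumes "x > 0"
  shows "1 / Gamma x \<le> exp (exp (c + 1)) * exp (- c * x)"
proof -
  define E where "E = exp (exp (c + 1))"
  have "exp (c + 1) powr x * exp (- exp (c + 1)) \<le> x * Gamma x"
    using Gamma_plus1_ge[OF assms, of "exp (c + 1)"] Gamma_plus1[OF pos_notin_nonpos_Ints[OF assms]]
    by simp
  hence "1 / Gamma x \<le> E * (x / (exp (c + 1) powr x))"
    using Gamma_real_pos[OF assms] by (simp add: E_def exp_minus field_simps)
  also have "x / (exp (c + 1) powr x) = x * exp (- ((c + 1) * x))"
    by (simp add: powr_def exp_minus divide_inverse mult.commute)
  also have "x * exp (- ((c + 1) * x)) = x * exp (- x) * exp (- c * x)"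
    by (simp add: algebra_simps flip: exp_add)
  also have "E * \<dots> \<le> E * (1 * exp (- c * x))"
    unfolding E_def by (intro mult_left_mono mult_right_mono mult_exp_minus_le_one) auto
  finally show ?thesis by (simp add: E_def)
qed

text \<open>
  \<open>Digamma\<close> increases and its derivative \<open>Polygamma 1\<close> is positive and decreasing, so by the mean value
  theorem its growth from \<open>x0\<close> onwards is bounded by its slope at \<open>x0\<close>.
\<close>
lemma Digamma_real_abs_le:
  fixes x x0 :: real
  assumes "x0 > 0" "x \<ge> x0"
  shows "\<bar>Digamma x\<bar> \<le> \<bar>Digamma x0\<bar> + Polygamma 1 x0 * x"
proof (cases "x = x0")
  case True
  have "Polygamma 1 x0 > 0"
    by (intro Polygamma_real_odd_pos pos_notin_nonpos_Ints assms) simp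
  with assms True show ?thesis by simp
next
  case False
  hence "\<exists>y. x0 < y \<and> y < x \<and> Digamma x - Digamma x0 = (x - x0) * Polygamma (Suc 0) y"
    using assms by (intro MVT2 derivative_intros impI allI) (auto elim!: nonpos_Ints_cases)
  then obtain y where y: "x0 < y" "y < x" "Digamma x - Digamma x0 = (x - x0) * Polygamma 1 y"
    by auto
  have P: "0 < Polygamma 1 x0"
    by (intro Polygamma_real_odd_pos pos_notin_nonpos_Ints assms) simp
  have "Polygamma 1 y \<le> Polygamma 1 x0"
    using Polygamma_real_strict_antimono[of x0 y 1] assms y by simp
  hence "(x - x0) * Polygamma 1 y \<le> (x - x0) * Polygamma 1 x0"
    using assms by (intro mult_left_mono) auto
  also have "\<dots> \<le> x * Polygamma 1 x0"
    using assms P by (intro mult_right_mono) auto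
  finally have "Digamma x - Digamma x0 \<le> Polygamma 1 x0 * x"
    using y(3) by (simp add: mult.commute)
  moreover have "Digamma x0 \<le> Digamma x"
    by (rule Digamma_real_mono) (use assms in auto)
  ultimately show ?thesis by linarith
qed

text \<open>
  The decay of \<open>1 / Gamma\<close> at the rate \<open>c + 1\<close> leaves a factor \<open>exp (- x)\<close> to absorb the linear
  growth of \<open>Digamma\<close>. The constant depends on \<open>x0\<close> through the value and the slope of \<open>Digamma\<close>
  there.
\<close>
lemma Digamma_over_Gamma_bound:
  fixes c x0 :: real
  assumes "x0 > 0"
  obtains C where "C \<ge> 0" "\<And>x. x \<ge> x0 \<Longrightarrow> \<bar>Digamma x / Gamma x\<bar> \<le> C * exp (- c * x)"
proof
  define A where "A = \<bar>Digamma x0\<bar>"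
  define P where "P = Polygamma 1 x0"
  define E where "E = exp (exp (c + 1 + 1))"
  have P: "P \<ge> 0"
    unfolding P_def by (intro less_imp_le Polygamma_real_odd_pos pos_notin_nonpos_Ints assms) simp
  have A: "A \<ge> 0" by (simp add: A_def)
  show "0 \<le> (A + P) * E" using A P by (simp add: E_def)
  fix x :: real assume x: "x \<ge> x0"
  hence x_pos: "x > 0" using assms by simp
  have "\<bar>Digamma x / Gamma x\<bar> = \<bar>Digamma x\<bar> * (1 / Gamma x)"
    using Gamma_real_pos[OF x_pos] by simp
  also have "\<dots> \<le> (A + P * x) * (E * exp (- (c + 1) * x))"
    unfolding A_def P_def E_def using Gamma_real_pos[OF x_pos] x_pos P[unfolded P_def]
    by (intro mult_mono Digamma_real_abs_le inverse_Gamma_le assms x) auto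
  also have "\<dots> = (A * exp (- x) + P * (x * exp (- x))) * (E * exp (- c * x))"
    by (simp add: algebra_simps flip: exp_add)
  also have "\<dots> \<le> (A * 1 + P * 1) * (E * exp (- c * x))"
    using x_pos A P unfolding E_def
    by (intro mult_right_mono add_mono mult_left_mono mult_exp_minus_le_one) auto
  finally show "\<bar>Digamma x / Gamma x\<bar> \<le> (A + P) * E * exp (- c * x)" by (simp add: mult.assoc)
qed

text \<open>
  An exponential decay rate \<open>c\<close> in \<open>x = \<alpha> * k + \<beta>\<close> is a geometric factor \<open>exp (- c * \<alpha>) ^ k\<close>.
  As \<open>c\<close> is arbitrary, this beats \<open>(2 * r) ^ k\<close> for every \<open>r\<close>.
\<close>
lemma summable_Digamma_over_Gamma:
  fixes \<alpha> \<beta> r :: real and w :: "nat \<Rightarrow> real"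
  assumes "\<alpha> > 0" "\<beta> > 0" "r \<ge> 0" and w: "\<And>k. \<bar>w k\<bar> \<le> 2 ^ k"
  shows "summable (\<lambda>k. \<bar>w k * Digamma (\<alpha> * real k + \<beta>) / Gamma (\<alpha> * real k + \<beta>)\<bar> * r ^ k)"
proof -
  (* This rate makes the terms at most C * (2 * r * exp (- 4 * r)) ^ k, and y * exp (- y) \<le> 1 at
     y = 4 * r bounds the ratio by 1 / 2. *)
  define c where "c = 4 * r / \<alpha>"
  obtain C where C: "C \<ge> 0" "\<And>x. x \<ge> \<beta> \<Longrightarrow> \<bar>Digamma x / Gamma x\<bar> \<le> C * exp (- c * x)"
    using Digamma_over_Gamma_bound[OF \<open>\<beta> > 0\<close>] by metis
  have "c \<ge> 0" using assms by (simp add: c_def)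
  show ?thesis
  proof (rule summable_comparison_test')
    show "summable (\<lambda>k. C * (1 / 2) ^ k :: real)"
      by (intro summable_mult summable_geometric) auto
    fix k :: nat
    have ck: "c * (\<alpha> * real k) = real k * (4 * r)" using assms by (simp add: c_def)
    have "\<bar>w k * Digamma (\<alpha> * real k + \<beta>) / Gamma (\<alpha> * real k + \<beta>)\<bar> =
            \<bar>w k\<bar> * \<bar>Digamma (\<alpha> * real k + \<beta>) / Gamma (\<alpha> * real k + \<beta>)\<bar>"
      by (simp add: abs_mult)
    also have "\<dots> \<le> 2 ^ k * (C * exp (- c * (\<alpha> * real k + \<beta>)))"
      using assms by (intro mult_mono w C) auto
    also have "exp (- c * (\<alpha> * real k + \<beta>)) \<le> exp (- (c * (\<alpha> * real k)))"
      using \<open>c \<ge> 0\<close> assms by (simp add: algebra_simps)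
    hence "2 ^ k * (C * exp (- c * (\<alpha> * real k + \<beta>))) \<le> 2 ^ k * (C * exp (- (4 * r)) ^ k)"
      using C(1) ck by (intro mult_left_mono) (simp_all flip: exp_of_nat_mult)
    finally have "\<bar>w k * Digamma (\<alpha> * real k + \<beta>) / Gamma (\<alpha> * real k + \<beta>)\<bar> * r ^ k
                    \<le> 2 ^ k * (C * exp (- (4 * r)) ^ k) * r ^ k"
      using assms by (intro mult_right_mono) auto
    also have "\<dots> = C * (1 / 2 * (4 * r * exp (- (4 * r)))) ^ k"
      by (simp add: power_mult_distrib)
    also have "\<dots> \<le> C * (1 / 2 * 1) ^ k"
      using assms C(1)
      by (intro mult_left_mono power_mono mult_exp_minus_le_one) auto
    finally show "norm (\<bar>w k * Digamma (\<alpha> * real k + \<beta>) / Gamma (\<alpha> * real k + \<beta>)\<bar> * r ^ k)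
                    \<le> C * (1 / 2) ^ k"
      using assms by (simp add: abs_mult)
  qed
qed

section \<open>Differentiating the Wright series in its parameters\<close>

text \<open>
  Keeping all arguments of \<open>Gamma\<close> above one \<open>x0 > 0\<close>, for every \<open>v > u0\<close>, bounds the termwise
  derivatives by constant multiples of \<open>(2 * \<bar>z\<bar>) ^ k / fact k\<close>, uniformly in \<open>v\<close>.
\<close>
lemma wright_series_has_derivative:
  fixes z u u0 x0 :: real and w d :: "nat \<Rightarrow> real"
  assumes x0: "x0 > 0" and ge: "\<And>k v. v > u0 \<Longrightarrow> w k * v + d k \<ge> x0"
    and w: "\<And>k. \<bar>w k\<bar> \<le> 2 ^ k" and u: "u > u0"
  defines "g \<equiv> (\<lambda>k v. w k * Digamma (w k * v + d k) / Gamma (w k * v + d k))"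
  shows "((\<lambda>v. \<Sum>k. z ^ k / (fact k * Gamma (w k * v + d k))) has_field_derivative
           (\<Sum>k. - g k u * (z ^ k / fact k))) (at u)"
    and "summable (\<lambda>k. - g k u * (z ^ k / fact k))"
proof -
  obtain C where C: "C \<ge> 0" "\<And>x. x \<ge> x0 \<Longrightarrow> \<bar>Digamma x / Gamma x\<bar> \<le> C * exp (- 0 * x)"
    using Digamma_over_Gamma_bound[OF x0] by metis
  have bound: "norm (- g k v * (z ^ k / fact k)) \<le> C * ((2 * \<bar>z\<bar>) ^ k / fact k)"
    if "v \<in> {u0<..}" for k v
  proof -
    have "norm (- g k v * (z ^ k / fact k)) =
            \<bar>w k\<bar> * \<bar>Digamma (w k * v + d k) / Gamma (w k * v + d k)\<bar> * (\<bar>z\<bar> ^ k / fact k)"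
      by (simp add: g_def abs_mult power_abs)
    also have "\<dots> \<le> 2 ^ k * C * (\<bar>z\<bar> ^ k / fact k)"
      using C ge[of v k] that by (intro mult_right_mono mult_mono w) auto
    finally show ?thesis by (simp add: power_mult_distrib mult_ac)
  qed
  have exp_sum: "summable (\<lambda>k. y ^ k / fact k)" for y :: real
    using summable_exp[of y] by (simp add: field_simps)
  have majorant: "summable (\<lambda>k. C * ((2 * \<bar>z\<bar>) ^ k / fact k))"
    by (intro summable_mult exp_sum)
  show "summable (\<lambda>k. - g k u * (z ^ k / fact k))"
    by (rule summable_comparison_test'[OF majorant]) (use bound u in auto)
  show "((\<lambda>v. \<Sum>k. z ^ k / (fact k * Gamma (w k * v + d k))) has_field_derivative
           (\<Sum>k. - g k u * (z ^ k / fact k))) (at u)"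
  proof (rule has_field_derivative_series'(2)[where S = "{u0<..}" and x0 = u])
    show "((\<lambda>v. z ^ k / (fact k * Gamma (w k * v + d k))) has_field_derivative
             - g k v * (z ^ k / fact k)) (at v within {u0<..})" if "v \<in> {u0<..}" for k v
    proof -
      have pos: "w k * v + d k > 0" using ge[of v k] that x0 by simp
      have ne: "Gamma (w k * v + d k) \<noteq> 0" using Gamma_real_pos[OF pos] by simp
      show ?thesis using pos ne
        by (auto intro!: derivative_eq_intros elim!: nonpos_Ints_cases
              simp: g_def field_simps power2_eq_square)
    qed
    show "uniformly_convergent_on {u0<..} (\<lambda>n v. \<Sum>i<n. - g i v * (z ^ i / fact i))"
      by (rule Weierstrass_m_test'[OF bound majorant])
    show "summable (\<lambda>k. z ^ k / (fact k * Gamma (w k * u + d k)))"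
    proof (rule summable_comparison_test')
      show "summable (\<lambda>k. exp (exp 1) * (\<bar>z\<bar> ^ k / fact k) :: real)"
        by (intro summable_mult exp_sum)
      fix k
      have pos: "w k * u + d k > 0" using ge[of u k] u x0 by simp
      have "norm (z ^ k / (fact k * Gamma (w k * u + d k))) =
              1 / Gamma (w k * u + d k) * (\<bar>z\<bar> ^ k / fact k)"
        using Gamma_real_pos[OF pos] by (simp add: abs_mult power_abs)
      also have "\<dots> \<le> exp (exp 1) * (\<bar>z\<bar> ^ k / fact k)"
        using inverse_Gamma_le[OF pos, of 0] by (intro mult_right_mono) auto
      finally show "norm (z ^ k / (fact k * Gamma (w k * u + d k)))
          \<le> exp (exp 1) * (\<bar>z\<bar> ^ k / fact k)" .
    qed
  qed (use u in \<open>auto simp: interior_open\<close>)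
qed

section \<open>Termwise Laplace transform of an entire function of exponential type zero\<close>

lemma power_times_exp_tendsto_0:
  fixes s :: complex
  assumes "Re s > 0"
  shows "((\<lambda>t::real. of_real t ^ k * exp (- (s * of_real t))) \<longlongrightarrow> 0) at_top"
proof (rule tendsto_norm_zero_cancel)
  have "filterlim (\<lambda>t. Re s * t) at_top at_top"
    using assms by (intro filterlim_tendsto_pos_mult_at_top[OF tendsto_const] filterlim_ident)
  hence "((\<lambda>t. (Re s * t) ^ k / exp (Re s * t)) \<longlongrightarrow> 0) at_top"
    by (rule filterlim_compose[OF tendsto_power_div_exp_0])
  hence "((\<lambda>t. (1 / Re s ^ k) * ((Re s * t) ^ k / exp (Re s * t))) \<longlongrightarrow> (1 / Re s ^ k) * 0) at_top"
    by (intro tendsto_intros)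
  hence "((\<lambda>t. t ^ k * exp (- (Re s * t))) \<longlongrightarrow> 0) at_top"
    using assms by (simp add: power_mult_distrib exp_minus field_simps)
  moreover have "\<forall>\<^sub>F t in at_top. t ^ k * exp (- (Re s * t)) =
                   norm (complex_of_real t ^ k * exp (- (s * of_real t)))"
    using eventually_ge_at_top[of 0]
    by eventually_elim (simp add: norm_mult norm_power)
  ultimately show "((\<lambda>t. norm (complex_of_real t ^ k * exp (- (s * of_real t)))) \<longlongrightarrow> 0) at_top"
    by (rule Lim_transform_eventually)
qed

text \<open>
  Integration by parts expresses an antiderivative for \<open>k + 1\<close> through one for \<open>k\<close>; the constant is
  normalised so that the antiderivative vanishes at infinity, and the Laplace integral can then
  be read off at \<open>0\<close>.
\<close>
lemma power_times_exp_antiderivative: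
  fixes s :: complex
  assumes "Re s > 0"
  obtains F :: "real \<Rightarrow> complex" where
    "\<And>t. (F has_vector_derivative of_real t ^ k * exp (- (s * of_real t))) (at t)"
    "F 0 = - (fact k / s ^ Suc k)" "(F \<longlongrightarrow> 0) at_top"
proof -
  have s: "s \<noteq> 0" using assms by auto
  have "\<exists>F. (\<forall>t. (F has_vector_derivative of_real t ^ k * exp (- (s * of_real t))) (at t)) \<and>
            F 0 = - (fact k / s ^ Suc k) \<and> (F \<longlongrightarrow> 0) (at_top :: real filter)"
  proof (induction k)
    case 0
    let ?F = "\<lambda>t::real. - (1 / s) * exp (- (s * of_real t))"
    have "(?F has_vector_derivative of_real t ^ 0 * exp (- (s * of_real t))) (at t)" for t
      using s by (auto intro!: derivative_eq_intros has_vector_derivative_real_field)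
    moreover have "(?F \<longlongrightarrow> - (1 / s) * 0) at_top"
      by (intro tendsto_mult_left) (use power_times_exp_tendsto_0[OF assms, of 0] in simp)
    ultimately show ?case by (intro exI[of _ ?F]) auto
  next
    case (Suc k)
    then obtain F where F:
      "\<And>t. (F has_vector_derivative of_real t ^ k * exp (- (s * of_real t))) (at t)"
      "F 0 = - (fact k / s ^ Suc k)" "(F \<longlongrightarrow> 0) (at_top :: real filter)" by blast
    let ?E = "\<lambda>t::real. of_real t ^ Suc k * exp (- (s * of_real t))"
    let ?G = "\<lambda>t::real. (of_nat (Suc k) / s) * F t - (1 / s) * ?E t"
    have E': "(?E has_vector_derivative (of_nat (Suc k) * of_real t ^ k * exp (- (s * of_real t))
                 - s * (of_real t ^ Suc k * exp (- (s * of_real t))))) (at t)" for t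
    proof (rule has_vector_derivative_real_field)
      show "((\<lambda>z. z ^ Suc k * exp (- (s * z))) has_field_derivative
              (of_nat (Suc k) * of_real t ^ k * exp (- (s * of_real t))
                 - s * (of_real t ^ Suc k * exp (- (s * of_real t))))) (at (of_real t))"
        by (rule derivative_eq_intros refl)+ (simp add: algebra_simps)
    qed
    have "(?G has_vector_derivative
             (of_nat (Suc k) / s) * (of_real t ^ k * exp (- (s * of_real t)))
             - (1 / s) * (of_nat (Suc k) * of_real t ^ k * exp (- (s * of_real t))
                 - s * (of_real t ^ Suc k * exp (- (s * of_real t))))) (at t)" for t
      by (intro has_vector_derivative_diff has_vector_derivative_mult_right F(1) E')
    hence "(?G has_vector_derivative of_real t ^ Suc k * exp (- (s * of_real t))) (at t)" for t
      using s by (simp add: right_diff_distrib mult_ac)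
    moreover have "(?G \<longlongrightarrow> (of_nat (Suc k) / s) * 0 - (1 / s) * 0) at_top"
      by (intro tendsto_intros F(3) power_times_exp_tendsto_0 assms)
    moreover have "?G 0 = - (fact (Suc k) / s ^ Suc (Suc k))"
      by (simp add: F(2))
    ultimately show ?case by (intro exI[of _ ?G]) auto
  qed
  thus thesis using that by blast
qed

text \<open>
  The boundary limits at \<open>0\<close> and \<open>\<infinity>\<close> in the extended-real form that the fundamental theorem of calculus
  for improper integrals expects.
\<close>
lemma tendsto_ereal_endpoints:
  fixes F :: "real \<Rightarrow> 'a::real_normed_vector"
  assumes "isCont F 0" "(F \<longlongrightarrow> L) at_top"
  shows "((F \<circ> real_of_ereal) \<longlongrightarrow> F 0) (at_right (ereal 0))"
    and "((F \<circ> real_of_ereal) \<longlongrightarrow> L) (at_left \<infinity>)"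
proof -
  have "(F \<longlongrightarrow> F 0) (at_right 0)"
    using assms(1) by (simp add: isCont_def filterlim_at_split)
  thus "((F \<circ> real_of_ereal) \<longlongrightarrow> F 0) (at_right (ereal 0))"
    by (simp only: ereal_tendsto_simps1)
  show "((F \<circ> real_of_ereal) \<longlongrightarrow> L) (at_left \<infinity>)"
    using assms(2) by (simp only: ereal_tendsto_simps1)
qed

text \<open>
  For real \<open>r\<close> the integrand is nonnegative, so the limits of the antiderivative give
  integrability as well as the value. This supplies the majorant for complex \<open>s\<close>, where the
  fundamental theorem presupposes integrability.
\<close>
lemma laplace_power_real:
  fixes r :: real
  assumes "r > 0"
  shows "set_integrable lborel {0<..} (\<lambda>t. t ^ k * exp (- (r * t)))"
    and "(LINT t:{0<..}|lborel. t ^ k * exp (- (r * t))) = fact k / r ^ Suc k"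
proof -
  from assms obtain F :: "real \<Rightarrow> complex" where F:
    "\<And>t. (F has_vector_derivative of_real t ^ k * exp (- (of_real r * of_real t))) (at t)"
    "F 0 = - (fact k / of_real r ^ Suc k)" "(F \<longlongrightarrow> 0) at_top"
    using power_times_exp_antiderivative[of "of_real r" k] by auto
  let ?G = "\<lambda>t. Re (F t)"
  have G': "(?G has_real_derivative t ^ k * exp (- (r * t))) (at t)" for t
  proof -
    have "(?G has_vector_derivative Re (of_real t ^ k * exp (- (of_real r * of_real t)))) (at t)"
      by (rule bounded_linear.has_vector_derivative[OF bounded_linear_Re F(1)])
    also have "of_real t ^ k * exp (- (of_real r * of_real t)) =
                 complex_of_real (t ^ k * exp (- (r * t)))"
      by (simp flip: exp_of_real)
    finally show ?thesis by (simp add: has_real_derivative_iff_has_vector_derivative)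
  qed
  have "F 0 = complex_of_real (- (fact k / r ^ Suc k))"
    using F(2) by simp
  hence G0: "?G 0 = - (fact k / r ^ Suc k)"
    by (metis Re_complex_of_real)
  have "(?G \<longlongrightarrow> Re 0) at_top" by (intro tendsto_Re F(3))
  hence Ginf: "(?G \<longlongrightarrow> 0) at_top" by simp
  note lims = tendsto_ereal_endpoints[OF DERIV_isCont[OF G'] Ginf]
  note FTC = interval_integral_FTC_nonneg[where a = "ereal 0" and b = \<infinity>
      and f = "\<lambda>t. t ^ k * exp (- (r * t))", OF _ G' _ _ lims]
  show "set_integrable lborel {0<..} (\<lambda>t. t ^ k * exp (- (r * t)))"
    using FTC(1) by (simp add: einterval_eq_Ici)
  show "(LINT t:{0<..}|lborel. t ^ k * exp (- (r * t))) = fact k / r ^ Suc k"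
    using FTC(2) G0 by (simp add: interval_lebesgue_integral_def einterval_eq_Ici)
qed

lemma laplace_power:
  fixes s :: complex
  assumes "Re s > 0"
  shows "set_integrable lborel {0<..} (\<lambda>t. of_real t ^ k * exp (- (s * of_real t)))" (is ?int)
    and "(LINT t:{0<..}|lborel. of_real t ^ k * exp (- (s * of_real t))) = fact k / s ^ Suc k"
proof -
  show int: ?int
  proof (rule set_integrable_bound[OF laplace_power_real(1)[OF assms]])
    show "set_borel_measurable lborel {0<..} (\<lambda>t. complex_of_real t ^ k * exp (- (s * of_real t)))"
      unfolding set_borel_measurable_def by measurable
    show "AE t in lborel. t \<in> {0<..} \<longrightarrow> norm (complex_of_real t ^ k * exp (- (s * of_real t)))
            \<le> norm (t ^ k * exp (- (Re s * t)))"
      by (simp add: norm_mult norm_power abs_mult power_abs)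
  qed
  obtain F :: "real \<Rightarrow> complex" where F:
    "\<And>t. (F has_vector_derivative of_real t ^ k * exp (- (s * of_real t))) (at t)"
    "F 0 = - (fact k / s ^ Suc k)" "(F \<longlongrightarrow> 0) at_top"
    using power_times_exp_antiderivative[OF assms] by metis
  have cont: "isCont F 0"
    using F(1) has_vector_derivative_continuous by blast
  have "(LBINT t=ereal 0..\<infinity>. complex_of_real t ^ k * exp (- (s * of_real t))) = 0 - F 0"
    by (rule interval_integral_FTC_integrable[OF _ F(1) _ _ tendsto_ereal_endpoints[OF cont F(3)]])
      (use int in \<open>auto simp: einterval_eq_Ici\<close>)
  thus "(LINT t:{0<..}|lborel. of_real t ^ k * exp (- (s * of_real t))) = fact k / s ^ Suc k"
    using F(2) by (simp add: interval_lebesgue_integral_def einterval_eq_Ici)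
qed

text \<open>
  The hypothesis on \<open>c\<close> is what makes \<open>0\<close> the abscissa for the series of absolute values:
  at each \<open>s\<close> with \<open>Re s > 0\<close> it is used with \<open>r = 1 / Re s\<close>, which can be arbitrarily large.
\<close>
lemma laplace_continuation_power_series:
  fixes c :: "nat \<Rightarrow> complex" and f :: "real \<Rightarrow> complex"
  assumes c: "\<And>r. r \<ge> 0 \<Longrightarrow> summable (\<lambda>k. norm (c k) * r ^ k)"
    and f: "\<And>t. t > 0 \<Longrightarrow> f t = (\<Sum>k. c k * (of_real t ^ k / fact k))"
  shows "laplace_continuation f 0 (UNIV - {0}) (\<lambda>s. 1 / s * (\<Sum>k. c k * inverse s ^ k))"
proof -
  have abs_sum: "summable (\<lambda>k. norm (c k * y ^ k))" for y
    using c[of "norm y"] by (simp add: norm_mult norm_power)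
  show ?thesis
    unfolding laplace_continuation_def
  proof (intro conjI allI impI)
    show "connected (UNIV - {0::complex})"
      using connected_punctured_universe[of "0::complex"] by (simp add: Compl_eq_Diff_UNIV)
    have "((\<lambda>y. \<Sum>k. c k * y ^ k) has_field_derivative (\<Sum>n. diffs c n * y ^ n)) (at y)" for y
      by (rule termdiffs_strong_converges_everywhere[OF summable_norm_cancel[OF abs_sum]])
    hence "(\<lambda>y. \<Sum>k. c k * y ^ k) holomorphic_on UNIV"
      unfolding holomorphic_on_def field_differentiable_def by auto
    hence "((\<lambda>y. \<Sum>k. c k * y ^ k) \<circ> inverse) holomorphic_on (UNIV - {0})"
      by (intro holomorphic_on_compose holomorphic_intros) (auto intro: holomorphic_on_subset)
    thus "(\<lambda>s. 1 / s * (\<Sum>k. c k * inverse s ^ k)) holomorphic_on UNIV - {0}"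
      by (intro holomorphic_intros) (auto simp: o_def)
  next
    fix s :: complex assume s: "Re s > 0"
    hence s0: "s \<noteq> 0" by auto
    define h where "h = (\<lambda>k t. c k / fact k * (of_real t ^ k * exp (- (s * of_real t))))"
    define H where "H = (\<lambda>k t. indicator {0<..} t *\<^sub>R h k t)"
    have int: "integrable lborel (H k)" for k
      using set_integrable_mult_right[OF laplace_power(1)[OF s, of k], of "c k / fact k"]
      by (simp add: H_def h_def set_integrable_def)
    have H_int: "integral\<^sup>L lborel (H k) = 1 / s * (c k * inverse s ^ k)" for k
    proof -
      have "integral\<^sup>L lborel (H k) =
              (LINT t:{0<..}|lborel. c k / fact k * (of_real t ^ k * exp (- (s * of_real t))))"
        by (simp only: set_lebesgue_integral_def H_def h_def)
      also have "\<dots> = c k / fact k * (fact k / s ^ Suc k)"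
        by (simp only: set_integral_mult_right laplace_power(2)[OF s])
      finally have "integral\<^sup>L lborel (H k) = c k / fact k * (fact k / s ^ Suc k)" .
      thus ?thesis by (simp add: field_simps)
    qed
    have norm_h: "norm (h k t) = norm (c k) / fact k * (t ^ k * exp (- (Re s * t)))" if "t > 0" for k t
      using that by (simp add: h_def norm_mult norm_divide norm_power)
    have norm_int: "(\<integral>t. norm (H k t) \<partial>lborel) = 1 / Re s * (norm (c k) * (1 / Re s) ^ k)" for k
    proof -
      have "(\<integral>t. norm (H k t) \<partial>lborel) =
              (LINT t:{0<..}|lborel. norm (c k) / fact k * (t ^ k * exp (- (Re s * t))))"
        unfolding set_lebesgue_integral_def
        by (rule Bochner_Integration.integral_cong) (auto simp: H_def norm_h split: split_indicator)
      also have "\<dots> = norm (c k) / fact k * (fact k / Re s ^ Suc k)"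
        by (simp only: set_integral_mult_right laplace_power_real(2)[OF s])
      finally show ?thesis by (simp add: field_simps)
    qed
    have sum_int: "summable (\<lambda>k. \<integral>t. norm (H k t) \<partial>lborel)"
      unfolding norm_int using c[of "1 / Re s"] s by (intro summable_mult) auto
    have pointwise: "summable (\<lambda>k. norm (H k t))" for t
    proof (cases "t > 0")
      case True
      have "summable (\<lambda>k. exp (- (Re s * t)) * (norm (c k) * t ^ k))"
        using True by (intro summable_mult c) auto
      thus ?thesis
      proof (rule summable_comparison_test')
        fix k :: nat
        have "norm (norm (H k t)) = exp (- (Re s * t)) * (norm (c k) * t ^ k) * (1 / fact k)"
          using True by (simp add: H_def norm_h)
        also have "\<dots> \<le> exp (- (Re s * t)) * (norm (c k) * t ^ k) * 1"
          using True by (intro mult_left_mono) (auto simp: fact_ge_1)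
        finally show "norm (norm (H k t)) \<le> exp (- (Re s * t)) * (norm (c k) * t ^ k)" by simp
      qed
    qed (simp add: H_def)
    have H_sum: "(\<Sum>k. H k t) = indicator {0<..} t *\<^sub>R (exp (- (s * of_real t)) * f t)" for t
    proof (cases "t > 0")
      case True
      have "summable (\<lambda>k. c k * (of_real t ^ k / fact k))"
      proof (rule summable_norm_cancel, rule summable_comparison_test')
        show "summable (\<lambda>k. norm (c k) * t ^ k)" using True by (intro c) auto
        fix k :: nat
        have "norm (norm (c k * (complex_of_real t ^ k / fact k))) = norm (c k) * t ^ k * (1 / fact k)"
          using True by (simp add: norm_mult norm_divide norm_power)
        also have "\<dots> \<le> norm (c k) * t ^ k * 1"
          using True by (intro mult_left_mono) (auto simp: fact_ge_1)
        finally show "norm (norm (c k * (complex_of_real t ^ k / fact k))) \<le> norm (c k) * t ^ k"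
          by simp
      qed
      hence "exp (- (s * of_real t)) * f t =
               (\<Sum>k. exp (- (s * of_real t)) * (c k * (of_real t ^ k / fact k)))"
        unfolding f[OF True] by (rule suminf_mult[symmetric])
      also have "\<dots> = (\<Sum>k. H k t)"
        using True by (simp add: H_def h_def mult_ac)
      finally show ?thesis using True by simp
    qed (simp add: H_def)
    have AE: "AE t in lborel. summable (\<lambda>k. norm (H k t))" using pointwise by simp
    show "laplace_convergent f s"
      using integrable_suminf[OF int AE sum_int]
      by (simp add: laplace_convergent_def set_integrable_def H_sum)
    have "laplace f s = (\<integral>t. (\<Sum>k. H k t) \<partial>lborel)"
      by (simp add: laplace_def set_lebesgue_integral_def H_sum)
    also have "\<dots> = (\<Sum>k. 1 / s * (c k * inverse s ^ k))"
      by (simp add: integral_suminf[OF int AE sum_int] H_int)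
    also have "\<dots> = 1 / s * (\<Sum>k. c k * inverse s ^ k)"
      by (rule suminf_mult[OF summable_norm_cancel[OF abs_sum]])
    finally show "laplace f s = 1 / s * (\<Sum>k. c k * inverse s ^ k)" .
  qed auto
qed

section \<open>Laplace transforms of the parameter derivatives\<close>

text \<open>
  The step from the derivative series to the transform that both parameters share. The sign \<open>\<sigma>\<close> and
  the minus sign from differentiating \<open>1 / Gamma\<close> go into the coefficients.
\<close>
lemma laplace_continuation_wright_derivative:
  fixes \<alpha> \<beta> \<sigma> :: real and w :: "nat \<Rightarrow> real" and f :: "real \<Rightarrow> real"
  assumes "\<alpha> > 0" "\<beta> > 0" "\<bar>\<sigma>\<bar> = 1" and w: "\<And>k. \<bar>w k\<bar> \<le> 2 ^ k"
  defines "q \<equiv> (\<lambda>k. w k * Digamma (\<alpha> * real k + \<beta>) / Gamma (\<alpha> * real k + \<beta>))"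
  assumes f: "\<And>t. t > 0 \<Longrightarrow> (\<lambda>k. - q k * ((\<sigma> * t) ^ k / fact k)) sums f t"
  defines "a \<equiv> (\<lambda>k (s::complex). of_real \<sigma> ^ k * s powi (- int k) * of_real (w k)
             * of_real (Digamma (\<alpha> * real k + \<beta>)) / of_real (Gamma (\<alpha> * real k + \<beta>)))"
  shows "summable (\<lambda>k. a k s)"
    and "laplace_continuation (\<lambda>t. of_real (f t)) 0 (UNIV - {0}) (\<lambda>s. - (1 / s) * (\<Sum>k. a k s))"
proof -
  define c :: "nat \<Rightarrow> complex" where "c = (\<lambda>k. of_real (- q k * \<sigma> ^ k))"
  have norm_c: "norm (c k) = \<bar>q k\<bar>" for k
    using assms(3) by (simp add: c_def norm_mult norm_power)
  have c_sum: "summable (\<lambda>k. norm (c k) * r ^ k)" if "r \<ge> 0" for r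
    unfolding norm_c q_def using assms(1,2) that w by (rule summable_Digamma_over_Gamma)
  have a_eq: "a k s = - (c k * inverse s ^ k)" for k s
    by (simp add: a_def c_def q_def power_int_minus power_inverse)
  have "summable (\<lambda>k. c k * inverse s ^ k)" for s
    using c_sum[of "norm (inverse s)"]
    by (intro summable_norm_cancel[of "\<lambda>k. c k * inverse s ^ k"]) (simp add: norm_mult norm_power)
  note c_sum' = this
  thus "summable (\<lambda>k. a k s)" unfolding a_eq by (intro summable_minus)
  have "laplace_continuation (\<lambda>t. of_real (f t)) 0 (UNIV - {0})
          (\<lambda>s. 1 / s * (\<Sum>k. c k * inverse s ^ k))"
  proof (rule laplace_continuation_power_series[OF c_sum])
    fix t :: real assume "t > 0"
    from sums_of_real[OF f[OF this], where 'a = complex]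
    have "(\<lambda>k. c k * (of_real t ^ k / fact k)) sums of_real (f t)"
      by (simp add: c_def power_mult_distrib mult_ac)
    thus "of_real (f t) = (\<Sum>k. c k * (of_real t ^ k / fact k))" by (simp add: sums_iff)
  qed
  also have "(\<lambda>s. 1 / s * (\<Sum>k. c k * inverse s ^ k)) = (\<lambda>s. - (1 / s) * (\<Sum>k. a k s))"
    unfolding a_eq by (simp add: suminf_minus[OF c_sum'])
  finally show "laplace_continuation (\<lambda>t. of_real (f t)) 0 (UNIV - {0})
                  (\<lambda>s. - (1 / s) * (\<Sum>k. a k s))" .
qed

theorem theorem5:
  fixes \<alpha> \<beta> \<sigma> :: real
  assumes "\<alpha> > 0" and "\<beta> > 0" and "\<sigma> \<in> {1, -1}"
  shows
    "(\<forall>t>0. (\<lambda>a. wright a \<beta> (\<sigma> * t)) field_differentiable at \<alpha>) \<and>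
     (\<forall>t>0. (\<lambda>b. wright \<alpha> b (\<sigma> * t)) field_differentiable at \<beta>) \<and>
     (\<forall>s::complex. s \<noteq> 0 \<longrightarrow>
        summable (\<lambda>k. of_real \<sigma> ^ k * s powi (- int k) * of_nat k
          * of_real (Digamma (\<alpha> * real k + \<beta>)) / of_real (Gamma (\<alpha> * real k + \<beta>)))) \<and>
     (\<forall>s::complex. s \<noteq> 0 \<longrightarrow>
        summable (\<lambda>k. of_real \<sigma> ^ k * s powi (- int k)
          * of_real (Digamma (\<alpha> * real k + \<beta>)) / of_real (Gamma (\<alpha> * real k + \<beta>)))) \<and>
     laplace_continuation (\<lambda>t. of_real (deriv (\<lambda>a. wright a \<beta> (\<sigma> * t)) \<alpha>)) 0 (UNIV - {0})
       (\<lambda>s. - (1 / s) * (\<Sum>k. of_real \<sigma> ^ k * s powi (- int k) * of_nat k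
          * of_real (Digamma (\<alpha> * real k + \<beta>)) / of_real (Gamma (\<alpha> * real k + \<beta>)))) \<and>
     laplace_continuation (\<lambda>t. of_real (deriv (\<lambda>b. wright \<alpha> b (\<sigma> * t)) \<beta>)) 0 (UNIV - {0})
       (\<lambda>s. - (1 / s) * (\<Sum>k. of_real \<sigma> ^ k * s powi (- int k)
          * of_real (Digamma (\<alpha> * real k + \<beta>)) / of_real (Gamma (\<alpha> * real k + \<beta>))))"

proof -
  have \<sigma>: "\<bar>\<sigma>\<bar> = 1" using assms(3) by auto
  have w\<alpha>: "\<bar>real k\<bar> \<le> 2 ^ k" for k
    using of_nat_mono[OF less_imp_le[OF less_exp[of k]], where 'a = real] by simp
  have w\<beta>: "\<bar>1\<bar> \<le> (2::real) ^ k" for k by simp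
  define f\<alpha> where "f\<alpha> = (\<lambda>t. deriv (\<lambda>a. wright a \<beta> (\<sigma> * t)) \<alpha>)"
  define f\<beta> where "f\<beta> = (\<lambda>t. deriv (\<lambda>b. wright \<alpha> b (\<sigma> * t)) \<beta>)"

  note D\<alpha> = wright_series_has_derivative[where u = \<alpha> and ?u0.0 = 0 and ?x0.0 = \<beta>
      and w = real and d = "\<lambda>_. \<beta>"]
  have deriv\<alpha>: "((\<lambda>a. wright a \<beta> z) has_field_derivative
      (\<Sum>k. - (real k * Digamma (\<alpha> * real k + \<beta>) / Gamma (\<alpha> * real k + \<beta>)) * (z ^ k / fact k))) (at \<alpha>)"
    and sum\<alpha>: "summable (\<lambda>k. - (real k * Digamma (\<alpha> * real k + \<beta>) / Gamma (\<alpha> * real k + \<beta>))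
                     * (z ^ k / fact k))" for z
    using D\<alpha>[of z] assms w\<alpha> by (simp_all add: wright_def mult.commute)
  have f\<alpha>: "(\<lambda>k. - (real k * Digamma (\<alpha> * real k + \<beta>) / Gamma (\<alpha> * real k + \<beta>))
              * ((\<sigma> * t) ^ k / fact k)) sums f\<alpha> t" for t
    unfolding f\<alpha>_def DERIV_imp_deriv[OF deriv\<alpha>] by (rule summable_sums[OF sum\<alpha>])

  (* The ray of admissible v starts at \<beta> / 2 instead of 0, because the term k = 0 has argument v
     itself, and all arguments need a common positive lower bound. *)
  note D\<beta> = wright_series_has_derivative[where u = \<beta> and ?u0.0 = "\<beta> / 2" and ?x0.0 = "\<beta> / 2"
      and w = "\<lambda>_. 1" and d = "\<lambda>k. \<alpha> * real k"]
  have ge: "1 * v + \<alpha> * real k \<ge> \<beta> / 2" if "v > \<beta> / 2" for v k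
  proof -
    have "\<alpha> * real k \<ge> 0" using assms by simp
    with that show ?thesis by linarith
  qed
  have deriv\<beta>: "((\<lambda>b. wright \<alpha> b z) has_field_derivative
      (\<Sum>k. - (1 * Digamma (\<alpha> * real k + \<beta>) / Gamma (\<alpha> * real k + \<beta>)) * (z ^ k / fact k))) (at \<beta>)"
    and sum\<beta>: "summable (\<lambda>k. - (1 * Digamma (\<alpha> * real k + \<beta>) / Gamma (\<alpha> * real k + \<beta>))
                     * (z ^ k / fact k))" for z
    using D\<beta>[OF _ ge w\<beta>, of z] assms by (simp_all add: wright_def add.commute)
  have f\<beta>: "(\<lambda>k. - (1 * Digamma (\<alpha> * real k + \<beta>) / Gamma (\<alpha> * real k + \<beta>))
              * ((\<sigma> * t) ^ k / fact k)) sums f\<beta> t" for t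
    unfolding f\<beta>_def DERIV_imp_deriv[OF deriv\<beta>] by (rule summable_sums[OF sum\<beta>])

  note L\<alpha> = laplace_continuation_wright_derivative[OF assms(1,2) \<sigma> w\<alpha> f\<alpha>]
  note L\<beta> = laplace_continuation_wright_derivative[OF assms(1,2) \<sigma> w\<beta> f\<beta>]
  have "(\<lambda>a. wright a \<beta> z) field_differentiable at \<alpha>"
    and "(\<lambda>b. wright \<alpha> b z) field_differentiable at \<beta>" for z
    using deriv\<alpha> deriv\<beta> unfolding field_differentiable_def by blast+
  with L\<alpha> L\<beta> show ?thesis
    unfolding f\<alpha>_def f\<beta>_def of_real_of_nat_eq of_real_1 mult_1_right by blast
qed

end
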